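(* Let $q$ be a prime power. If there exists an $[[n,k,d]]_q$ stabilizer code that is pure to $d'$, then there exists for all $r$ in the range $0\le r<k$ an $[[n,k-r,r,\ge d]]_q$ subsystem code that is pure to $\min\{d,d'\}$. If a pure $[[n,k,r,d]]_q$ subsystem code exists, then a pure $[[n,k+r,d]]_q$ stabilizer code exists. Moreover, both assertions also hold with all the codes in the hypothesis and in the conclusion required to be $\mathbf{F}_q$-linear.
   Context: Let $p$ be the characteristic of $\mathbf{F}_q$. For $(x|y)\in\mathbf{F}_q^{2n}$ (with $x,y\in\mathbf{F}_q^n$), $\mathrm{swt}(x|y)$ is the number of $i$ with $(x_i,y_i)\ne(0,0)$, and $\mathrm{swt}(S)$ is the minimum of $\mathrm{swt}$ over the nonzero elements of $S$. The trace-symplectic product of $(a|b)$ and $(a'|b')$ is $\mathrm{tr}_{q/p}(a'\cdot b-a\cdot b')$, and $C^{\perp_s}$ is the dual of $C\subseteq\mathbf{F}_q^{2n}$ with respect to it. All subsystem codes are Clifford subsystem codes: an $((n,K,R,d))_q$ subsystem code is a subspace $Q=A\otimes B$ of $\mathbf{C}^{q^n}$, $\dim A=K$, $\dim B=R$, arising from an additive code; concretely, its existence means that there is an additive subgroup $C\le\mathbf{F}_q^{2n}$ (the zero code is allowed) with $D=C\cap C^{\perp_s}$ such that $|C|=q^nR/K$, $|D|=q^n/(KR)$, and $d=\mathrm{swt}(D^{\perp_s}\setminus C)$ if $D^{\perp_s}\ne C$, while $d=\mathrm{swt}(D^{\perp_s})$ if $D^{\perp_s}=C$ (the case $K=1$).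 The subsystem code is $\mathbf{F}_q$-linear if $C$ is an $\mathbf{F}_q$-linear subspace of $\mathbf{F}_q^{2n}$. $[[n,k,r,d]]_q$ means $((n,q^k,q^r,d))_q$; an $[[n,k,d]]_q$ stabilizer code is the same as an $[[n,k,0,d]]_q$ subsystem code. Writing $\ge d$ in the last position means that the minimum distance is some $\tilde d\ge d$. The code derived from $C$ is pure to $d'$ if $C$ contains no nonzero element of symplectic weight less than $d'$; it is pure if it is pure to its minimum distance $d$. *)

theory Defs
  imports
    "HOL-Analysis.Analysis"
    "HOL-Computational_Algebra.Computational_Algebra"
begin

text \<open>
  Throughout, the field \<open>F\<^sub>q\<close> is a type \<open>'a\<close> of class \<open>finite_field\<close>, so that
  \<open>q = CARD('a)\<close> and \<open>p = CHAR('a)\<close>; the length is \<open>n = CARD('n)\<close>, and an element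
  \<open>(x|y)\<close> of \<open>F\<^sub>q\<^sup>2\<^sup>n\<close> is the pair \<open>(x, y)\<close>.
\<close>

type_synonym ('a, 'n) symp_vec = "('a ^ 'n) \<times> ('a ^ 'n)"

definition swt :: "('a::zero, 'n::finite) symp_vec \<Rightarrow> nat" where
  "swt v = card {i. (fst v $ i, snd v $ i) \<noteq> (0, 0)}"

text \<open>
  \<open>Min\<close> is unspecified if \<open>S\<close> has no nonzero element. This does not happen where
  \<open>swt_set\<close> is used below: if \<open>D = C \<inter> C\<^sup>\<bottom>\<close>, then \<open>D\<^sup>\<bottom>\<close> contains \<open>C\<close> and has at least
  \<open>q\<^sup>n > 1\<close> elements.
\<close>

definition swt_set :: "('a::zero, 'n::finite) symp_vec set \<Rightarrow> nat" where
  "swt_set S = Min (swt ` (S - {0}))"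

text \<open>
  As \<open>CARD('a)\<close> is a power of the prime \<open>CHAR('a)\<close>, the number of summands is the degree \<open>m\<close>
  with \<open>q = p\<^sup>m\<close>. The trace is considered as an element of \<open>'a\<close>, lying in the prime subfield.
\<close>

definition field_trace :: "'a::finite_field \<Rightarrow> 'a" where
  "field_trace x = (\<Sum>i<multiplicity CHAR('a) CARD('a). x ^ (CHAR('a) ^ i))"

definition trace_symp ::
  "('a::finite_field, 'n::finite) symp_vec \<Rightarrow> ('a, 'n) symp_vec \<Rightarrow> 'a" where
  "trace_symp v w =
     field_trace (scalar_product (fst w) (snd v) - scalar_product (fst v) (snd w))"

definition symp_dual ::
  "('a::finite_field, 'n::finite) symp_vec set \<Rightarrow> ('a, 'n) symp_vec set" where
  "symp_dual C = {v. \<forall>w\<in>C. trace_symp w v = 0}"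

definition additive_code :: "('a::finite_field, 'n::finite) symp_vec set \<Rightarrow> bool" where
  "additive_code C \<longleftrightarrow> 0 \<in> C \<and> (\<forall>v\<in>C. \<forall>w\<in>C. v + w \<in> C) \<and> (\<forall>v\<in>C. - v \<in> C)"

definition linear_code :: "('a::finite_field, 'n::finite) symp_vec set \<Rightarrow> bool" where
  "linear_code C \<longleftrightarrow> module.subspace (\<lambda>c v. (c *s fst v, c *s snd v)) C"

text \<open>\<open>C\<close> gives rise to an \<open>((n,K,R,d))\<^sub>q\<close> Clifford subsystem code.\<close>

definition clifford_subsystem_code ::
  "('a::finite_field, 'n::finite) symp_vec set \<Rightarrow> nat \<Rightarrow> nat \<Rightarrow> nat \<Rightarrow> bool" where
  "clifford_subsystem_code C K R d \<longleftrightarrow>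
     additive_code C \<and>
     (let D = C \<inter> symp_dual C in
        real (card C) = real CARD('a) ^ CARD('n) * real R / real K \<and>
        real (card D) = real CARD('a) ^ CARD('n) / (real K * real R) \<and>
        d = (if symp_dual D \<noteq> C then swt_set (symp_dual D - C) else swt_set (symp_dual D)))"

text \<open>\<open>C\<close> gives rise to an \<open>[[n,k,r,d]]\<^sub>q\<close> subsystem code, an \<open>[[n,k,d]]\<^sub>q\<close> stabilizer code.\<close>

definition subsystem_code ::
  "('a::finite_field, 'n::finite) symp_vec set \<Rightarrow> nat \<Rightarrow> nat \<Rightarrow> nat \<Rightarrow> bool" where
  "subsystem_code C k r d \<longleftrightarrow> clifford_subsystem_code C (CARD('a) ^ k) (CARD('a) ^ r) d"

definition stabilizer_code ::
  "('a::finite_field, 'n::finite) symp_vec set \<Rightarrow> nat \<Rightarrow> nat \<Rightarrow> bool" where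
  "stabilizer_code C k d \<longleftrightarrow> subsystem_code C k 0 d"

definition pure_to :: "('a::finite_field, 'n::finite) symp_vec set \<Rightarrow> nat \<Rightarrow> bool" where
  "pure_to C d' \<longleftrightarrow> \<not> (\<exists>v\<in>C. v \<noteq> 0 \<and> swt v < d')"

end

theory Submission
  imports Defs
begin

text \<open>
  A stabilizer code is a self-orthogonal \<open>D\<close>. Adjoining to \<open>D\<close> hyperbolic pairs from its dual yields
  the subsystem codes \<open>C\<close> with \<open>C \<inter> C\<^sup>\<bottom> = D\<close>; since \<open>D \<subseteq> C \<subseteq> D\<^sup>\<bottom>\<close>, the distance does not drop.
  Conversely, a pure subsystem code \<open>C\<close> gives the stabilizer code \<open>D = C \<inter> C\<^sup>\<bottom>\<close>.

  This has a gap if \<open>D\<^sup>\<bottom> = C \<noteq> D\<close>: if all vectors of minimum weight \<open>d\<close> in \<open>D\<^sup>\<bottom>\<close> lie in \<open>D\<close>, the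
  distance of \<open>D\<close> as a stabilizer code exceeds \<open>d\<close>. In this case \<open>D\<close> is replaced by its image under
  the isometry \<open>x \<mapsto> x + B x y z + B x z y\<close>, where \<open>y\<close> has weight one, \<open>B v y \<noteq> 0\<close> for some \<open>v \<in> D\<close> of
  weight \<open>d\<close>, \<open>z \<in> D\<^sup>\<bottom> - D\<close>, and \<open>B z y = 0\<close>.

  The additive codes are the case of scalars in the prime field and the trace-symplectic form \<open>B\<close>,
  the linear codes the case of scalars in the whole field and the symplectic form, for which the dual
  of a linear code is the same as for the trace-symplectic form.
\<close>

subsection \<open>Finite vector spaces over a subfield\<close>

text \<open>
  The subfield is a set \<open>K\<close> rather than a type, because both the prime field and the whole field
  are needed as fields of scalars.
\<close>

locale scalar_subfield = vector_space scale
  for scale :: "'a::finite_field \<Rightarrow> 'v::{ab_group_add, finite} \<Rightarrow> 'v" (infixr "\<cdot>" 75) +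
  fixes K :: "'a set"
  assumes one_K: "1 \<in> K"
    and diff_K: "a \<in> K \<Longrightarrow> b \<in> K \<Longrightarrow> a - b \<in> K"
    and mult_K: "a \<in> K \<Longrightarrow> b \<in> K \<Longrightarrow> a * b \<in> K"
begin

lemma zero_K: "0 \<in> K"
  using diff_K[OF one_K one_K] by simp

lemma minus_K: "a \<in> K \<Longrightarrow> - a \<in> K"
  using diff_K[OF zero_K, of a] by simp

lemma add_K: "a \<in> K \<Longrightarrow> b \<in> K \<Longrightarrow> a + b \<in> K"
  using diff_K[of a "- b"] minus_K[of b] by simp

lemma power_K: "a \<in> K \<Longrightarrow> a ^ i \<in> K"
  by (induction i) (auto intro: one_K mult_K)

text \<open>Finiteness makes closure under products enough: since \<open>a ^ q = a\<close>, the
  power \<open>a ^ (q - 2)\<close> is the inverse of a nonzero \<open>a\<close>.\<close>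

lemma inverse_K:
  assumes "a \<in> K"
  shows "inverse a \<in> K"
proof (cases "a = 0")
  case False
  have "CARD('a) \<ge> card {0, 1 :: 'a}"
    by (intro card_mono) auto
  then obtain m where m: "CARD('a) = 2 + m"
    by (metis card_2_iff le_Suc_ex zero_neq_one)
  then have "a * (a ^ m * a) = a * 1"
    using finite_field_power_card_eq_same[of a] by (simp add: mult_ac)
  then have "inverse a = a ^ m"
    using False by (intro inverse_unique) (simp add: mult_ac)
  then show ?thesis
    using power_K[OF assms] by simp
qed (simp add: zero_K)

lemma card_K_pos: "card K > 0"
  using one_K by (auto simp: card_gt_0_iff)

lemma card_K_gt_1: "card K > 1"
  using card_mono[of K "{0, 1}"] zero_K one_K by auto

definition ksubspace :: "'v set \<Rightarrow> bool" where
  "ksubspace S \<longleftrightarrow> 0 \<in> S \<and> (\<forall>u\<in>S. \<forall>v\<in>S. u + v \<in> S) \<and> (\<forall>c\<in>K. \<forall>v\<in>S. c \<cdot> v \<in> S)"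

lemma ksubspace_0: "ksubspace S \<Longrightarrow> 0 \<in> S"
  and ksubspace_add: "ksubspace S \<Longrightarrow> u \<in> S \<Longrightarrow> v \<in> S \<Longrightarrow> u + v \<in> S"
  and ksubspace_scale: "ksubspace S \<Longrightarrow> c \<in> K \<Longrightarrow> v \<in> S \<Longrightarrow> c \<cdot> v \<in> S"
  by (auto simp: ksubspace_def)

lemma ksubspace_uminus: "ksubspace S \<Longrightarrow> v \<in> S \<Longrightarrow> - v \<in> S"
  using ksubspace_scale[OF _ minus_K[OF one_K]] by simp

lemma ksubspace_diff: "ksubspace S \<Longrightarrow> u \<in> S \<Longrightarrow> v \<in> S \<Longrightarrow> u - v \<in> S"
  using ksubspace_add[OF _ _ ksubspace_uminus, of S u v] by simp

lemma ksubspace_Int: "ksubspace S \<Longrightarrow> ksubspace T \<Longrightarrow> ksubspace (S \<inter> T)"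
  by (auto simp: ksubspace_def)

lemma ksubspace_singleton_0: "ksubspace {0}"
  by (simp add: ksubspace_def)

lemma ksubspace_UNIV: "ksubspace UNIV"
  by (simp add: ksubspace_def)

section \<open>Adjoining a vector, and induction along chains of subspaces\<close>

definition adjoin :: "'v set \<Rightarrow> 'v \<Rightarrow> 'v set" where
  "adjoin S x = (\<lambda>(s, c). s + c \<cdot> x) ` (S \<times> K)"

lemma adjoinI: "s \<in> S \<Longrightarrow> c \<in> K \<Longrightarrow> s + c \<cdot> x \<in> adjoin S x"
  by (force simp: adjoin_def)

lemma adjoinE:
  assumes "v \<in> adjoin S x"
  obtains s c where "s \<in> S" "c \<in> K" "v = s + c \<cdot> x"
  using assms by (auto simp: adjoin_def)

lemma subset_adjoin: "S \<subseteq> adjoin S x"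
  using adjoinI[OF _ zero_K, of _ S x] by auto

lemma mem_adjoin: "ksubspace S \<Longrightarrow> x \<in> adjoin S x"
  using adjoinI[OF ksubspace_0 one_K, of S x] by simp

lemma ksubspace_adjoin:
  assumes "ksubspace S"
  shows "ksubspace (adjoin S x)"
  unfolding ksubspace_def
proof (intro conjI ballI)
  show "0 \<in> adjoin S x"
    using subset_adjoin ksubspace_0[OF assms] by blast
next
  fix u v assume "u \<in> adjoin S x" "v \<in> adjoin S x"
  then obtain s c t d where "s \<in> S" "c \<in> K" "u = s + c \<cdot> x" "t \<in> S" "d \<in> K" "v = t + d \<cdot> x"
    by (meson adjoinE)
  moreover from this have "u + v = (s + t) + (c + d) \<cdot> x"
    by (simp only: scale_left_distrib add_ac)
  ultimately show "u + v \<in> adjoin S x"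
    by (metis adjoinI add_K ksubspace_add[OF assms])
next
  fix c v assume "c \<in> K" "v \<in> adjoin S x"
  moreover from this obtain t d where "t \<in> S" "d \<in> K" "v = t + d \<cdot> x"
    by (meson adjoinE)
  moreover from this have "c \<cdot> v = c \<cdot> t + (c * d) \<cdot> x"
    by (simp add: scale_right_distrib)
  ultimately show "c \<cdot> v \<in> adjoin S x"
    by (simp add: adjoinI mult_K ksubspace_scale[OF assms])
qed

lemma adjoin_subset:
  assumes "ksubspace T" "S \<subseteq> T" "x \<in> T"
  shows "adjoin S x \<subseteq> T"
  using assms by (auto elim!: adjoinE intro!: ksubspace_add ksubspace_scale)

text \<open>If two sums agreed with \<open>c \<noteq> d\<close>, dividing by \<open>c - d\<close>
  would put \<open>x\<close> into \<open>S\<close>.\<close>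

lemma card_adjoin:
  assumes S: "ksubspace S" and "x \<notin> S"
  shows "card (adjoin S x) = card S * card K"
proof -
  have "inj_on (\<lambda>(s, c). s + c \<cdot> x) (S \<times> K)"
  proof (rule inj_onI, clarify)
    fix s c t d
    assume *: "s \<in> S" "c \<in> K" "t \<in> S" "d \<in> K" "s + c \<cdot> x = t + d \<cdot> x"
    then have eq: "(c - d) \<cdot> x = t - s"
      by (simp add: scale_left_diff_distrib algebra_simps)
    show "s = t \<and> c = d"
    proof (cases "c = d")
      case False
      have "inverse (c - d) \<cdot> (t - s) \<in> S"
        using * by (intro ksubspace_scale ksubspace_diff S inverse_K diff_K)
      then have "inverse (c - d) \<cdot> (c - d) \<cdot> x \<in> S"
        by (simp only: eq)
      then show ?thesis
        using False \<open>x \<notin> S\<close> by simp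
    qed (use * in simp)
  qed
  then show ?thesis
    by (simp add: adjoin_def card_image card_cartesian_product)
qed

text \<open>Takes the place of basis extension: \<open>U\<close> is reached from \<open>S\<close> by
  adjoining one new vector at a time, so that counting needs no dimensions.\<close>

lemma ksubspace_chain_induct [consumes 3, case_names base step]:
  assumes "ksubspace S" "ksubspace U" "S \<subseteq> U"
    and "P S"
    and step: "\<And>T x. ksubspace T \<Longrightarrow> x \<notin> T \<Longrightarrow> P T \<Longrightarrow> P (adjoin T x)"
  shows "P U"
  using assms(1,3,4)
proof (induction "card (U - S)" arbitrary: S rule: less_induct)
  case less
  show ?case
  proof (cases "S = U")
    case False
    then obtain x where x: "x \<in> U" "x \<notin> S"
      using less.prems by blast
    have "U - adjoin S x \<subset> U - S"
      using subset_adjoin[of S x] mem_adjoin[OF less.prems(1), of x] x by blast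
    then have "card (U - adjoin S x) < card (U - S)"
      by (simp add: psubset_card_mono)
    then show ?thesis
      using less x by (intro less.hyps[of "adjoin S x"])
        (auto intro: ksubspace_adjoin adjoin_subset[THEN subsetD] step assms(2))
  qed (use less in simp)
qed

text \<open>Used for the field as a space over its prime field, to see that \<open>q\<close> is a
  power of \<open>p\<close>.\<close>

lemma card_UNIV_power_card_K: "\<exists>m. CARD('v) = card K ^ m"
  using ksubspace_singleton_0 ksubspace_UNIV subset_UNIV
proof (induction rule: ksubspace_chain_induct)
  case base
  show ?case
    by (intro exI[of _ 0]) simp
next
  case (step T x)
  then obtain m where "card T = card K ^ m"
    by blast
  then show ?case
    using card_adjoin[OF step(1,2)] by (intro exI[of _ "Suc m"]) simp
qed

end

subsection \<open>Orthogonal complements\<close>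

text \<open>Homogeneity is asked over \<open>K\<close> only, because the trace-symplectic form is
  linear just over the prime field. The form is taken alternating, not merely antisymmetric, to
  cover characteristic two.\<close>

locale symplectic_form = scalar_subfield scale K
  for scale :: "'a::finite_field \<Rightarrow> 'v::{ab_group_add, finite} \<Rightarrow> 'v" (infixr "\<cdot>" 75)
    and K :: "'a set" +
  fixes B :: "'v \<Rightarrow> 'v \<Rightarrow> 'a"
  assumes B_mem_K: "B u v \<in> K"
    and B_add_left: "B (u + v) w = B u w + B v w"
    and B_add_right: "B w (u + v) = B w u + B w v"
    and B_scale_left: "c \<in> K \<Longrightarrow> B (c \<cdot> u) v = c * B u v"
    and B_self: "B v v = 0"
    and B_nondegenerate: "v \<noteq> 0 \<Longrightarrow> \<exists>w. B v w \<noteq> 0"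
begin

lemma B_antisym: "B v u = - B u v"
proof -
  have "B (u + v) (u + v) = B v u + B u v"
    unfolding B_add_left B_add_right by (simp add: B_self)
  then have "B v u + B u v = 0"
    by (simp only: B_self)
  then show ?thesis
    by (simp add: eq_neg_iff_add_eq_0)
qed

lemma B_scale_right: "c \<in> K \<Longrightarrow> B u (c \<cdot> v) = c * B u v"
  using B_scale_left[of c v u] B_antisym[of u v] B_antisym[of u "c \<cdot> v"] by simp

lemma B_minus_left: "B (- u) v = - B u v"
  using B_scale_left[OF minus_K[OF one_K], of u v] by simp

lemma B_diff_left: "B (u - v) w = B u w - B v w"
  using B_add_left[of u "- v" w] by (simp add: B_minus_left)

lemma B_0_left: "B 0 v = 0"
  using B_diff_left[of 0 0 v] by simp

lemma B_0_right: "B v 0 = 0"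
  using B_antisym[of v 0] by (simp add: B_0_left)

definition perp :: "'v set \<Rightarrow> 'v set" where
  "perp S = {v. \<forall>w\<in>S. B w v = 0}"

lemma perpI: "(\<And>w. w \<in> S \<Longrightarrow> B w v = 0) \<Longrightarrow> v \<in> perp S"
  and perpD: "v \<in> perp S \<Longrightarrow> w \<in> S \<Longrightarrow> B w v = 0"
  by (auto simp: perp_def)

lemma perpD': "v \<in> perp S \<Longrightarrow> w \<in> S \<Longrightarrow> B v w = 0"
  using B_antisym[of v w] by (simp add: perp_def)

lemma ksubspace_perp: "ksubspace (perp S)"
  by (simp add: ksubspace_def perp_def B_0_right B_add_right B_scale_right)

lemma subset_perp_perp: "S \<subseteq> perp (perp S)"
  by (auto intro!: perpI dest: perpD')

lemma subset_perp_swap: "S \<subseteq> perp T \<Longrightarrow> T \<subseteq> perp S"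
  by (meson perpD' perpI subset_iff)

lemma perp_singleton_0: "perp {0} = UNIV"
  by (auto simp: perp_def B_0_left)

lemma perp_UNIV: "perp UNIV = {0}"
proof -
  have "v = 0" if "v \<in> perp UNIV" for v
    using that B_nondegenerate[of v] perpD' by blast
  then show ?thesis
    using ksubspace_0[OF ksubspace_perp] by blast
qed

text \<open>The functional \<open>B x\<close> has at most \<open>card K\<close> values, and
  subtracting a fixed element of a nonempty fibre maps that fibre injectively into the
  kernel.\<close>

lemma card_le_card_kernel:
  assumes T: "ksubspace T"
  shows "card T \<le> card {t \<in> T. B x t = 0} * card K"
proof -
  have fibre: "card {t \<in> T. B x t = c} \<le> card {t \<in> T. B x t = 0}" for c
  proof (cases "{t \<in> T. B x t = c} = {}")
    case False
    then obtain t0 where t0: "t0 \<in> T" "B x t0 = c"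
      by blast
    show ?thesis
    proof (rule card_inj_on_le[of "\<lambda>t. t - t0"])
      have "B x (t - t0) = 0" if "B x t = c" for t
        using that t0 B_diff_left[of t t0 x] B_antisym[of x t] B_antisym[of x t0] B_antisym[of x "t - t0"]
        by (metis right_minus_eq minus_minus neg_equal_0_iff_equal)
      then show "(\<lambda>t. t - t0) ` {t \<in> T. B x t = c} \<subseteq> {t \<in> T. B x t = 0}"
        using t0 by (auto intro: ksubspace_diff T)
    qed (auto intro: inj_onI)
  next
    case True
    then show ?thesis
      by (simp only: card.empty)
  qed
  have "T = (\<Union>c\<in>K. {t \<in> T. B x t = c})"
    using B_mem_K by blast
  then have "card T \<le> (\<Sum>c\<in>K. card {t \<in> T. B x t = c})"
    by (metis card_UN_le finite)
  also have "\<dots> \<le> (\<Sum>c\<in>K. card {t \<in> T. B x t = 0})"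
    by (intro sum_mono fibre)
  finally show ?thesis
    by (simp add: mult.commute)
qed

text \<open>Adjoining a vector outside \<open>T\<close> multiplies \<open>card T\<close> by
  \<open>card K\<close>, while the complement, cut down by one functional, loses at most this
  factor.\<close>

lemma card_times_card_perp_mono:
  assumes "ksubspace S" "ksubspace U" "S \<subseteq> U"
  shows "card S * card (perp S) \<le> card U * card (perp U)"
  using assms
proof (induction rule: ksubspace_chain_induct)
  case (step T x)
  have "{t \<in> perp T. B x t = 0} \<subseteq> perp (adjoin T x)"
    by (auto intro!: perpI elim!: adjoinE simp: B_add_left B_scale_left perpD)
  then have "card {t \<in> perp T. B x t = 0} \<le> card (perp (adjoin T x))"
    by (simp add: card_mono)
  then have "card (perp T) \<le> card (perp (adjoin T x)) * card K"
    using card_le_card_kernel[OF ksubspace_perp, of T x] by (meson mult_le_mono1 order_trans)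
  then have "card T * card (perp T) \<le> card T * (card (perp (adjoin T x)) * card K)"
    by simp
  also have "\<dots> = card (adjoin T x) * card (perp (adjoin T x))"
    by (simp add: card_adjoin[OF step(1,2)])
  finally show ?case
    using step.IH by linarith
qed simp

text \<open>The product is monotone in \<open>S\<close> and takes the same value at \<open>{0}\<close> and at \<open>UNIV\<close>.\<close>

lemma card_times_card_perp:
  assumes "ksubspace S"
  shows "card S * card (perp S) = CARD('v)"
proof (rule antisym)
  show "card S * card (perp S) \<le> CARD('v)"
    using card_times_card_perp_mono[OF assms ksubspace_UNIV] by (simp add: perp_UNIV)
  show "CARD('v) \<le> card S * card (perp S)"
    using card_times_card_perp_mono[OF ksubspace_singleton_0 assms] ksubspace_0[OF assms]
    by (simp add: perp_singleton_0)
qed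

text \<open>One inclusion is clear, and the counting identity for \<open>S\<close> and for
  \<open>perp S\<close> gives both sides the same size.\<close>

lemma perp_perp:
  assumes "ksubspace S"
  shows "perp (perp S) = S"
proof -
  have "card (perp S) > 0"
    using ksubspace_0[OF ksubspace_perp, of S] by (auto simp: card_gt_0_iff)
  then have "card (perp (perp S)) = card S"
    using card_times_card_perp[OF assms] card_times_card_perp[OF ksubspace_perp, of S]
    by (metis mult.commute mult_cancel2 less_irrefl)
  then show ?thesis
    using subset_perp_perp by (metis card_subset_eq finite)
qed

text \<open>Each step adjoins a hyperbolic pair of \<open>perp C\<close>.\<close>

lemma exists_ksubspace_with_radical:
  assumes D: "ksubspace D" "D \<subseteq> perp D"
    and "card D * card K ^ (2 * j) \<le> card (perp D)"
  shows "\<exists>C. ksubspace C \<and> D \<subseteq> C \<and> C \<subseteq> perp D \<and> C \<inter> perp C = D \<and>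
           card C = card D * card K ^ (2 * j)"
  using assms(3)
proof (induction j)
  case 0
  then show ?case
    using D by (intro exI[of _ D]) auto
next
  case (Suc j)
  have D_pos: "card D > 0"
    using ksubspace_0[OF D(1)] by (auto simp: card_gt_0_iff)
  have less: "card D * card K ^ (2 * j) < card D * card K ^ (2 * Suc j)"
    using D_pos less_1_mult[OF card_K_gt_1 card_K_gt_1] card_K_pos by simp
  then obtain C where C: "ksubspace C" "D \<subseteq> C" "C \<subseteq> perp D" "C \<inter> perp C = D"
      "card C = card D * card K ^ (2 * j)"
    using Suc.IH Suc.prems by (meson less_imp_le order_trans)
  have D_perp_C: "D \<subseteq> perp C"
    by (rule subset_perp_swap[OF C(3)])
  \<comment> \<open>Equality would give \<open>card C = card (perp D)\<close>, but the assumed bound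
    leaves room for one more pair.\<close>
  have "perp C \<noteq> D"
  proof
    assume "perp C = D"
    then have "card C * card D = card (perp D) * card D"
      using card_times_card_perp[OF C(1)] card_times_card_perp[OF D(1)]
      by (simp add: mult.commute)
    then show False
      using C(5) less Suc.prems D_pos by simp
  qed
  then obtain a where a: "a \<in> perp C" "a \<notin> D"
    using D_perp_C by blast
  then have "a \<notin> C"
    using C(4) by blast
  \<comment> \<open>As \<open>a\<close> is not in \<open>C = perp (perp C)\<close>, it is not
    orthogonal to all of \<open>perp C\<close>.\<close>
  then obtain b where b: "b \<in> perp C" "B b a \<noteq> 0"
    using perp_perp[OF C(1)] perpI[of "perp C" a] by blast
  have ab: "B a b \<noteq> 0"
    using b(2) B_antisym[of b a] by simp
  define C1 where "C1 = adjoin C a"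
  define C2 where "C2 = adjoin C1 b"
  have C1: "ksubspace C1"
    unfolding C1_def by (rule ksubspace_adjoin[OF C(1)])
  have "b \<notin> C1"
  proof
    assume "b \<in> C1"
    then obtain s c where "s \<in> C" "c \<in> K" "b = s + c \<cdot> a"
      unfolding C1_def by (rule adjoinE)
    then show False
      using b(2) perpD[OF a(1)] by (simp add: B_add_left B_scale_left B_self)
  qed
  then have card_C2: "card C2 = card D * card K ^ (2 * Suc j)"
    using C(5) card_adjoin[OF C1, of b] card_adjoin[OF C(1) \<open>a \<notin> C\<close>]
    by (simp add: C1_def C2_def)
  have "C1 \<subseteq> C2" "C \<subseteq> C1"
    unfolding C1_def C2_def by (rule subset_adjoin)+
  have mem: "a \<in> C2" "b \<in> C2"
    using \<open>C1 \<subseteq> C2\<close> mem_adjoin[OF C(1), of a] mem_adjoin[OF C1, of b]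
    by (auto simp: C1_def C2_def)
  have perp_mono: "perp C \<subseteq> perp D"
    using C(2) by (auto simp: perp_def)
  have C2_perp: "C2 \<subseteq> perp D"
    unfolding C2_def C1_def using C(3) a(1) b(1) perp_mono
    by (intro adjoin_subset ksubspace_perp) auto
  have "x \<in> D" if x: "x \<in> C2" "x \<in> perp C2" for x
  proof -
    obtain y d where y: "y \<in> C1" "d \<in> K" "x = y + d \<cdot> b"
      using x(1) unfolding C2_def by (rule adjoinE)
    obtain s c where s: "s \<in> C" "c \<in> K" "y = s + c \<cdot> a"
      using y(1) unfolding C1_def by (rule adjoinE)
    have sab: "B s a = 0" "B s b = 0"
      using s(1) a(1) b(1) perpD by blast+
    \<comment> \<open>Pairing \<open>x = s + c \<cdot> a + d \<cdot> b\<close> with \<open>a\<close>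
      and \<open>b\<close> isolates \<open>d\<close> and \<open>c\<close>.\<close>
    have "B x a = d * B b a" "B x b = c * B a b"
      using y s sab by (simp_all add: B_add_left B_scale_left B_self)
    then have "d = 0" "c = 0"
      using perpD'[OF x(2) mem(1)] perpD'[OF x(2) mem(2)] b(2) ab by simp_all
    then have "x = s"
      using y s by simp
    then show "x \<in> D"
      using s(1) x(2) C(4) \<open>C \<subseteq> C1\<close> \<open>C1 \<subseteq> C2\<close> perpI[of C x] perpD by blast
  qed
  moreover have "D \<subseteq> perp C2"
    by (rule subset_perp_swap[OF C2_perp])
  ultimately have "C2 \<inter> perp C2 = D"
    using C(2) \<open>C \<subseteq> C1\<close> \<open>C1 \<subseteq> C2\<close> by blast
  then show ?case
    using card_C2 C2_perp C(2) \<open>C \<subseteq> C1\<close> \<open>C1 \<subseteq> C2\<close> ksubspace_adjoin[OF C1, of b]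
    by (intro exI[of _ C2]) (auto simp: C2_def)
qed

text \<open>A Siegel (Eichler) transvection, an isometry if \<open>B z y = 0\<close>.\<close>

definition siegel :: "'v \<Rightarrow> 'v \<Rightarrow> 'v \<Rightarrow> 'v" where
  "siegel y z x = x + B x y \<cdot> z + B x z \<cdot> y"

text \<open>Terms with one correction cancel in pairs by antisymmetry, such as
  \<open>B u z * B v y\<close> with \<open>B u z * B y v\<close>; those with two contain a pairing
  among \<open>y\<close> and \<open>z\<close>, which is zero.\<close>

lemma B_siegel:
  assumes "B z y = 0"
  shows "B (siegel y z u) (siegel y z v) = B u v"
proof -
  have "B y z = 0"
    using assms B_antisym[of y z] by simp
  then show ?thesis
    using assms
    by (simp add: siegel_def B_add_left B_add_right B_scale_left B_scale_right B_mem_K B_self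
        B_antisym[of y u] B_antisym[of z u] B_antisym[of y v] B_antisym[of z v] algebra_simps)
qed

lemma inj_siegel:
  assumes "B z y = 0"
  shows "inj (siegel y z)"
proof (rule injI)
  fix u v assume "siegel y z u = siegel y z v"
  then have "B (u - v) w = 0" for w
    using B_siegel[OF assms, of u w] B_siegel[OF assms, of v w] by (simp add: B_diff_left)
  then show "u = v"
    using B_nondegenerate[of "u - v"] by auto
qed

lemma ksubspace_siegel_image:
  assumes S: "ksubspace S"
  shows "ksubspace (siegel y z ` S)"
proof -
  let ?T = "siegel y z"
  have add: "?T u + ?T v = ?T (u + v)" for u v
    by (simp add: siegel_def B_add_left scale_left_distrib)
  have scale: "c \<cdot> ?T u = ?T (c \<cdot> u)" if "c \<in> K" for c u
    using that by (simp add: siegel_def B_scale_left scale_right_distrib)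
  have zero: "?T 0 = 0"
    by (simp add: siegel_def B_0_left)
  show ?thesis
    unfolding ksubspace_def
  proof (intro conjI ballI)
    show "0 \<in> ?T ` S"
      using zero ksubspace_0[OF S] by (metis image_eqI)
  next
    fix u v assume "u \<in> ?T ` S" "v \<in> ?T ` S"
    then show "u + v \<in> ?T ` S"
      using ksubspace_add[OF S] by (auto simp: add)
  next
    fix c v assume "c \<in> K" "v \<in> ?T ` S"
    then show "c \<cdot> v \<in> ?T ` S"
      using ksubspace_scale[OF S] by (auto simp: scale)
  qed
qed

text \<open>On a finite space the injective isometry is bijective, so every vector orthogonal to the
  image is itself an image.\<close>

lemma perp_siegel_image:
  assumes "B z y = 0"
  shows "perp (siegel y z ` S) = siegel y z ` perp S"
proof -
  have "surj (siegel y z)"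
    using inj_siegel[OF assms] by (simp add: finite_UNIV_inj_surj)
  then show ?thesis
    by (fastforce simp: perp_def B_siegel[OF assms] image_iff surj_def)
qed

end

subsection \<open>Symplectic weights\<close>

abbreviation pscale :: "'a \<Rightarrow> ('a::field, 'n::finite) symp_vec \<Rightarrow> ('a, 'n) symp_vec" where
  "pscale c v \<equiv> (c *s fst v, c *s snd v)"

text \<open>A coordinate in the support of \<open>u\<close> but not of \<open>v\<close> survives in
  \<open>u + v\<close>. This limits the weight lost by adding \<open>v\<close>.\<close>

lemma swt_le_swt_add: "swt u \<le> swt (u + v) + swt v"
  for u v :: "('a::finite_field, 'n::finite) symp_vec"
proof -
  have "swt u \<le> card ({i. (fst (u + v) $ i, snd (u + v) $ i) \<noteq> (0, 0)} \<union>
      {i. (fst v $ i, snd v $ i) \<noteq> (0, 0)})"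
    unfolding swt_def by (intro card_mono) auto
  also have "\<dots> \<le> swt (u + v) + swt v"
    unfolding swt_def by (rule card_Un_le)
  finally show ?thesis .
qed

lemma swt_pscale_le: "swt (pscale c v) \<le> swt v"
  unfolding swt_def by (intro card_mono) auto

lemma swt_set_in:
  fixes S :: "('a::finite_field, 'n::finite) symp_vec set"
  assumes "u \<in> S" "u \<noteq> 0"
  shows "swt_set S \<in> swt ` (S - {0})"
  unfolding swt_set_def using assms by (intro Min_in) auto

lemma swt_set_le:
  fixes S :: "('a::finite_field, 'n::finite) symp_vec set"
  assumes "u \<in> S" "u \<noteq> 0"
  shows "swt_set S \<le> swt u"
  unfolding swt_set_def using assms by (intro Min_le) auto

lemma swt_set_eqI:
  fixes S :: "('a::finite_field, 'n::finite) symp_vec set"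
  assumes "u \<in> S" "u \<noteq> 0" "swt u = d"
    and "\<And>v. v \<in> S \<Longrightarrow> v \<noteq> 0 \<Longrightarrow> d \<le> swt v"
  shows "swt_set S = d"
  unfolding swt_set_def using assms by (intro Min_eqI) auto

lemma vector_space_pscale: "vector_space (pscale :: 'a \<Rightarrow> ('a::field, 'n::finite) symp_vec \<Rightarrow> _)"
  by unfold_locales (simp_all add: vec_eq_iff prod_eq_iff algebra_simps)

lemma card_symp_vec: "CARD(('a::finite, 'n::finite) symp_vec) = CARD('a) ^ CARD('n) * CARD('a) ^ CARD('n)"
  by simp

subsection \<open>Subsystem codes over a field of scalars\<close>

text \<open>Clears the denominators in the cardinality conditions, so that later counting stays in
  the natural numbers.\<close>

lemma real_card_iff:
  fixes a n r k :: nat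
  assumes "k > 0"
  shows "real a = real n * real r / real k \<longleftrightarrow> a * k = n * r"
    and "real a = real n / real k \<longleftrightarrow> a * k = n"
  using assms by (simp_all add: field_simps flip: of_nat_mult)

lemma subsystem_code_iff:
  fixes C :: "('a::finite_field, 'n::finite) symp_vec set"
  shows "subsystem_code C k r d \<longleftrightarrow> additive_code C \<and>
    card C * CARD('a) ^ k = CARD('a) ^ CARD('n) * CARD('a) ^ r \<and>
    card (C \<inter> symp_dual C) * CARD('a) ^ (k + r) = CARD('a) ^ CARD('n) \<and>
    d = (if symp_dual (C \<inter> symp_dual C) \<noteq> C then swt_set (symp_dual (C \<inter> symp_dual C) - C)
         else swt_set (symp_dual (C \<inter> symp_dual C)))"
  using real_card_iff(1)[of "CARD('a) ^ k" "card C" "CARD('a) ^ CARD('n)" "CARD('a) ^ r"]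
    real_card_iff(2)[of "CARD('a) ^ k * CARD('a) ^ r" "card (C \<inter> symp_dual C)" "CARD('a) ^ CARD('n)"]
  by (simp add: subsystem_code_def clifford_subsystem_code_def Let_def power_add)

text \<open>\<open>B_local\<close> supplies the weight-one vector of the transvection.
  \<open>symp_dual_eq\<close> is restricted to subspaces because the symplectic form yields the
  trace-symplectic dual only for linear codes. \<open>card_field\<close> turns powers of
  \<open>q\<close> into powers of \<open>card K\<close>.\<close>

locale code_form = symplectic_form pscale K B
  for K :: "'a::finite_field set"
    and B :: "('a, 'n::finite) symp_vec \<Rightarrow> ('a, 'n) symp_vec \<Rightarrow> 'a" +
  assumes B_local: "v \<noteq> 0 \<Longrightarrow> \<exists>y. swt y \<le> 1 \<and> B v y \<noteq> 0"
    and symp_dual_eq: "ksubspace C \<Longrightarrow> symp_dual C = perp C"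
    and card_field: "\<exists>m. CARD('a) = card K ^ m"
begin

lemma additive_code_if_ksubspace: "ksubspace C \<Longrightarrow> additive_code C"
  by (simp add: additive_code_def ksubspace_0 ksubspace_add ksubspace_uminus)

text \<open>Substitute \<open>q ^ n = card D * q ^ k\<close> into
  \<open>card D * card (perp D) = q ^ (2 * n)\<close> and cancel \<open>card D\<close>.\<close>

lemma card_perp_eq:
  assumes D: "ksubspace D" "card D * CARD('a) ^ k = CARD('a) ^ CARD('n)"
  shows "card (perp D) = card D * (CARD('a) ^ k * CARD('a) ^ k)"
proof -
  have "card D > 0"
    using ksubspace_0[OF D(1)] by (auto simp: card_gt_0_iff)
  moreover have "card D * card (perp D) = card D * (card D * (CARD('a) ^ k * CARD('a) ^ k))"
    using card_times_card_perp[OF D(1)]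
    by (simp add: card_symp_vec mult_ac del: card_prod flip: D(2))
  ultimately show ?thesis
    by auto
qed

text \<open>The new code \<open>C'\<close> has radical \<open>C\<close> and lies between
  \<open>C\<close> and \<open>perp C\<close>. So the distance is taken over a smaller set, and a
  nonzero vector of \<open>C'\<close> lies in \<open>C\<close> (weight at least \<open>d'\<close>)
  or in \<open>perp C - C\<close> (weight at least \<open>d\<close>).\<close>

lemma subsystem_if_stabilizer:
  assumes C: "ksubspace C" "stabilizer_code C k d" "pure_to C d'" and "r < k"
  shows "\<exists>C' e. e \<ge> d \<and> ksubspace C' \<and> subsystem_code C' (k - r) r e \<and> pure_to C' (min d d')"
proof -
  let ?q = "CARD('a)"
  have q: "?q > 1"
    using card_mono[of UNIV "{0, 1 :: 'a}"] by simp
  have card_C: "card C * ?q ^ k = ?q ^ CARD('n)"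
    and "card (C \<inter> perp C) * ?q ^ k = ?q ^ CARD('n)"
    using C(2) symp_dual_eq[OF C(1)] by (simp_all add: stabilizer_code_def subsystem_code_iff)
  \<comment> \<open>With \<open>r = 0\<close> the two cardinality conditions have the same
    right-hand side.\<close>
  then have "card (C \<inter> perp C) * ?q ^ k = card C * ?q ^ k"
    by simp
  then have "card (C \<inter> perp C) = card C"
    by simp
  then have CC: "C \<inter> perp C = C"
    by (intro card_subset_eq) auto
  then have isotropic: "C \<subseteq> perp C"
    by blast
  have C_pos: "card C > 0"
    using ksubspace_0[OF C(1)] by (auto simp: card_gt_0_iff)
  obtain m where m: "?q = card K ^ m"
    using card_field by blast
  have qr: "card K ^ (2 * (m * r)) = ?q ^ r * ?q ^ r"
    by (simp add: m mult_2 power_add flip: power_mult)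
  have perp_C: "card (perp C) = card C * (?q ^ k * ?q ^ k)"
    by (rule card_perp_eq[OF C(1) card_C])
  have less: "?q ^ r * ?q ^ r < ?q ^ k * ?q ^ k"
    using q \<open>r < k\<close> by (intro mult_strict_mono power_strict_increasing) auto
  obtain C' where C': "ksubspace C'" "C \<subseteq> C'" "C' \<subseteq> perp C" "C' \<inter> perp C' = C"
    "card C' = card C * (?q ^ r * ?q ^ r)"
    using exists_ksubspace_with_radical[OF C(1) isotropic, of "m * r"] perp_C less
    by (auto simp: qr)
  \<comment> \<open>Here \<open>r < k\<close> enters: the distance of \<open>C'\<close> falls under
    the first case of the definition, and the minimum \<open>e\<close> is attained.\<close>
  have "card C' < card (perp C)"
    using C'(5) perp_C less C_pos by simp
  then have C'_neq: "perp C \<noteq> C'"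
    by auto
  then obtain u where u: "u \<in> perp C - C'"
    using C'(3) by blast
  have "perp C \<noteq> C"
    using C'(2,3) C'_neq by blast
  then have d: "d = swt_set (perp C - C)"
    using C(2) CC symp_dual_eq[OF C(1)] by (simp add: stabilizer_code_def subsystem_code_iff)
  define e where "e = swt_set (perp C - C')"
  have "u \<noteq> 0"
    using u ksubspace_0[OF C'(1)] by blast
  then have "e \<in> swt ` (perp C - C' - {0})"
    unfolding e_def using u by (intro swt_set_in[of u])
  then have "d \<le> e"
    unfolding d using C'(2) by (auto intro: swt_set_le)
  have "card C' * ?q ^ (k - r) = card C * ?q ^ r * ?q ^ (r + (k - r))"
    unfolding C'(5) by (simp only: power_add mult.assoc)
  also have "\<dots> = ?q ^ CARD('n) * ?q ^ r"
    using \<open>r < k\<close> by (simp flip: card_C)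
  finally have "card C' * ?q ^ (k - r) = ?q ^ CARD('n) * ?q ^ r" .
  then have "subsystem_code C' (k - r) r e"
    using C' C'_neq card_C \<open>r < k\<close>
    by (simp add: subsystem_code_iff additive_code_if_ksubspace symp_dual_eq C(1) e_def)
  moreover have "pure_to C' (min d d')"
    unfolding pure_to_def
  proof clarify
    fix v assume v: "v \<in> C'" "v \<noteq> 0" "swt v < min d d'"
    show False
    proof (cases "v \<in> C")
      case True
      then show False
        using v C(3) by (auto simp: pure_to_def)
    next
      case False
      then have "d \<le> swt v"
        unfolding d using v C'(3) by (intro swt_set_le) auto
      then show False
        using v by simp
    qed
  qed
  ultimately show ?thesis
    using \<open>d \<le> e\<close> C'(1) by blast
qed

text \<open>The vector \<open>u\<close> outside \<open>D\<close> ensures that \<open>d\<close> is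
  the exact distance and not just a lower bound.\<close>

lemma pure_stabilizer_codeI:
  assumes D: "ksubspace D" "D \<subseteq> perp D" "card D * CARD('a) ^ k = CARD('a) ^ CARD('n)"
    and ge: "\<And>u. u \<in> perp D \<Longrightarrow> u \<noteq> 0 \<Longrightarrow> d \<le> swt u"
    and u: "u \<in> perp D" "u \<notin> D" "swt u = d"
  shows "stabilizer_code D k d \<and> pure_to D d"
proof
  have "D \<inter> perp D = D"
    using D(2) by blast
  moreover have "perp D \<noteq> D"
    using u by blast
  moreover have "swt_set (perp D - D) = d"
    using u ge ksubspace_0[OF D(1)] by (intro swt_set_eqI[of u]) auto
  ultimately show "stabilizer_code D k d"
    using D(1,3)
    by (simp add: stabilizer_code_def subsystem_code_iff additive_code_if_ksubspace symp_dual_eq)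
  show "pure_to D d"
    using D(2) ge by (fastforce simp: pure_to_def)
qed

text \<open>
  The summand \<open>B x z \<cdot> y\<close> lowers the weight of \<open>t = x + B x y \<cdot> z\<close> by at most one, and it vanishes if
  \<open>t\<close> has weight \<open>d\<close>, as then \<open>t \<in> D\<close> is orthogonal to \<open>z\<close>.
\<close>

lemma exists_pure_stabilizer_code:
  assumes D: "ksubspace D" "D \<subseteq> perp D" "card D * CARD('a) ^ k = CARD('a) ^ CARD('n)"
    and neq: "perp D \<noteq> D"
    and ge: "\<And>u. u \<in> perp D \<Longrightarrow> u \<noteq> 0 \<Longrightarrow> d \<le> swt u"
    and v: "v \<in> perp D" "v \<noteq> 0" "swt v = d"
  shows "\<exists>D'. ksubspace D' \<and> stabilizer_code D' k d \<and> pure_to D' d"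
proof (cases "\<exists>u. u \<in> perp D \<and> u \<notin> D \<and> swt u = d")
  case True
  then obtain u where "u \<in> perp D" "u \<notin> D" "swt u = d"
    by blast
  then show ?thesis
    using pure_stabilizer_codeI[OF D ge, of u] D(1) by blast
next
  case False
  then have in_D: "u \<in> D" if "u \<in> perp D" "swt u = d" for u
    using that by blast
  obtain y where y: "swt y \<le> 1" "B v y \<noteq> 0"
    using B_local[OF v(2)] by blast
  obtain z0 where z0: "z0 \<in> perp D" "z0 \<notin> D"
    using neq D(2) by blast
  \<comment> \<open>Chosen such that \<open>B z y = 0\<close>; since \<open>v \<in> D\<close>, the
    correction does not move \<open>z0\<close> into \<open>D\<close>.\<close>
  define c where "c = B z0 y * inverse (B v y)"
  define z where "z = z0 - pscale c v"
  have c: "c \<in> K"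
    unfolding c_def by (intro mult_K inverse_K B_mem_K)
  have "v \<in> D"
    using v by (simp add: in_D)
  then have cv: "pscale c v \<in> D"
    using ksubspace_scale[OF D(1) c] by blast
  have "z \<notin> D"
  proof
    assume "z \<in> D"
    then have "z + pscale c v \<in> D"
      using cv by (rule ksubspace_add[OF D(1)])
    then show False
      using z0(2) by (simp add: z_def)
  qed
  have z: "z \<in> perp D"
    unfolding z_def using z0(1) cv D(2) by (intro ksubspace_diff[OF ksubspace_perp]) auto
  have zy: "B z y = 0"
    using y(2) unfolding z_def B_diff_left B_scale_left[OF c] by (simp add: c_def)
  let ?T = "siegel y z"
  \<comment> \<open>The preimage of \<open>v\<close> under the transvection. It lies outside
    \<open>D\<close>, so \<open>v\<close> lies outside the image of \<open>D\<close> and attains the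
    weight \<open>d\<close> there.\<close>
  define w where "w = v - pscale (B v y) z"
  have Bvy: "pscale (B v y) z \<in> perp D"
    using ksubspace_scale[OF ksubspace_perp B_mem_K z] .
  have "w \<in> perp D"
    unfolding w_def using Bvy v(1) by (intro ksubspace_diff[OF ksubspace_perp])
  have "w \<notin> D"
  proof
    assume "w \<in> D"
    then have "v - w \<in> D"
      using \<open>v \<in> D\<close> by (intro ksubspace_diff[OF D(1)])
    then have "pscale (inverse (B v y)) (pscale (B v y) z) \<in> D"
      using ksubspace_scale[OF D(1) inverse_K[OF B_mem_K], of "v - w"] by (simp add: w_def)
    then have "pscale (inverse (B v y) * B v y) z \<in> D"
      by (simp only: scale_scale)
    then show False
      using y(2) \<open>z \<notin> D\<close> by simp
  qed
  have "B v z = 0"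
    using perpD[OF z \<open>v \<in> D\<close>] .
  then have "B w y = B v y" "B w z = 0"
    unfolding w_def B_diff_left B_scale_left[OF B_mem_K] by (simp_all add: zy B_self)
  then have Tw: "?T w = v"
    by (simp add: siegel_def w_def zero_prod_def)
  have perp_T: "perp (?T ` D) = ?T ` perp D"
    by (rule perp_siegel_image[OF zy])
  have "d \<le> swt (?T x)" if x: "x \<in> perp D" and Tx: "?T x \<noteq> 0" for x
  proof -
    define t where "t = x + pscale (B x y) z"
    have t: "t \<in> perp D"
      unfolding t_def using ksubspace_scale[OF ksubspace_perp B_mem_K z] x
      by (intro ksubspace_add[OF ksubspace_perp])
    have Btz: "B t z = B x z"
      unfolding t_def B_add_left B_scale_left[OF B_mem_K] by (simp add: B_self)
    have Bty: "B t y = B x y"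
      unfolding t_def B_add_left B_scale_left[OF B_mem_K] by (simp add: zy)
    have T: "?T x = t + pscale (B x z) y"
      by (simp add: siegel_def t_def)
    have "t \<noteq> 0"
    proof
      assume "t = 0"
      then have "B x y = 0" "B x z = 0"
        using Bty Btz by (simp_all add: B_0_left)
      then show False
        using \<open>t = 0\<close> Tx by (simp add: T zero_prod_def)
    qed
    then have "d \<le> swt t"
      by (rule ge[OF t])
    show ?thesis
    proof (cases "swt t = d")
      case True
      then have "B x z = 0"
        using perpD[OF z in_D[OF t]] Btz by simp
      then show ?thesis
        using True by (simp add: T flip: zero_prod_def)
    next
      case False
      have "swt t \<le> swt (?T x) + swt y"
        unfolding T using swt_le_swt_add[of t "pscale (B x z) y"] swt_pscale_le[of "B x z" y]
        by linarith
      then show ?thesis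
        using False \<open>d \<le> swt t\<close> y(1) by linarith
    qed
  qed
  then have T_ge: "d \<le> swt u" if "u \<in> perp (?T ` D)" "u \<noteq> 0" for u
    using that unfolding perp_T by blast
  have "v \<in> perp (?T ` D)"
    unfolding perp_T using \<open>w \<in> perp D\<close> Tw by blast
  moreover have "v \<notin> ?T ` D"
    using \<open>w \<notin> D\<close> Tw inj_image_mem_iff[OF inj_siegel[OF zy], of w D] by simp
  moreover have "card (?T ` D) = card D"
    by (intro card_image inj_on_subset[OF inj_siegel[OF zy]]) simp
  moreover have "?T ` D \<subseteq> perp (?T ` D)"
    unfolding perp_T using D(2) by blast
  moreover have "ksubspace (?T ` D)"
    by (rule ksubspace_siegel_image[OF D(1)])
  ultimately have "stabilizer_code (?T ` D) k d \<and> pure_to (?T ` D) d"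
    using D(3) v(3) by (intro pure_stabilizer_codeI[of "?T ` D" k d v] T_ge) auto
  then show ?thesis
    using \<open>ksubspace (?T ` D)\<close> by blast
qed

text \<open>Purity of \<open>C\<close> makes \<open>d\<close> the minimum weight of the whole of
  \<open>perp D\<close>, where \<open>D\<close> is the radical;
  \<open>exists_pure_stabilizer_code\<close> then provides a minimum-weight vector outside the
  stabilizer.\<close>

lemma pure_stabilizer_if_pure_subsystem:
  assumes C: "ksubspace C" "subsystem_code C k r d" "pure_to C d"
  shows "\<exists>D. ksubspace D \<and> stabilizer_code D (k + r) d \<and> pure_to D d"
proof -
  define D where "D = C \<inter> perp C"
  have D: "ksubspace D"
    unfolding D_def by (intro ksubspace_Int C(1) ksubspace_perp)
  have code: "card C * CARD('a) ^ k = CARD('a) ^ CARD('n) * CARD('a) ^ r"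
    "card D * CARD('a) ^ (k + r) = CARD('a) ^ CARD('n)"
    "d = (if perp D \<noteq> C then swt_set (perp D - C) else swt_set (perp D))"
    using C(2) symp_dual_eq[OF C(1)] symp_dual_eq[OF D]
    by (simp_all add: subsystem_code_iff D_def)
  have C_perp: "C \<subseteq> perp D"
    by (rule subset_perp_swap) (simp add: D_def)
  then have isotropic: "D \<subseteq> perp D"
    by (auto simp: D_def)
  have pure: "d \<le> swt u" if "u \<in> C" "u \<noteq> 0" for u
    using C(3) that by (force simp: pure_to_def)
  show ?thesis
  proof (cases "perp D = D")
    \<comment> \<open>\<open>C\<close> lies between \<open>D\<close> and \<open>perp D\<close>, so
      all three coincide and both codes use the second case for the distance.\<close>
    case True
    then have "C = D"
      using C_perp by (auto simp: D_def)
    have "stabilizer_code D (k + r) d"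
      using code True \<open>C = D\<close> D
      by (simp add: stabilizer_code_def subsystem_code_iff additive_code_if_ksubspace symp_dual_eq)
    then show ?thesis
      using D C(3) \<open>C = D\<close> by blast
  next
    case neq: False
    obtain v where v: "v \<in> perp D" "v \<noteq> 0" "swt v = d"
      and ge: "\<And>u. u \<in> perp D \<Longrightarrow> u \<noteq> 0 \<Longrightarrow> d \<le> swt u"
    proof (cases "perp D = C")
      case True
      obtain u where "u \<in> perp D" "u \<noteq> 0"
        using neq isotropic ksubspace_0[OF D] by blast
      then have "d \<in> swt ` (perp D - {0})"
        using swt_set_in[of u "perp D"] code(3) True by simp
      then show ?thesis
        using pure True that by blast
    next
      case False
      obtain u where "u \<in> perp D - C" "u \<noteq> 0"
        using False C_perp ksubspace_0[OF C(1)] by blast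
      then have "d \<in> swt ` (perp D - C - {0})"
        using swt_set_in[of u "perp D - C"] code(3) False by simp
      moreover have "d \<le> swt u" if "u \<in> perp D" "u \<noteq> 0" for u
        using that pure[of u] swt_set_le[of u "perp D - C"] code(3) False by (cases "u \<in> C") auto
      ultimately show ?thesis
        using that by blast
    qed
    show ?thesis
      by (rule exists_pure_stabilizer_code[OF D isotropic code(2) neq ge v])
  qed
qed

end

subsection \<open>The prime field and the trace\<close>

lemma power_CHAR_of_nat: "of_nat n ^ CHAR('a) = (of_nat n :: 'a::finite_field)"
proof (induction n)
  case (Suc n)
  then show ?case
    using freshmans_dream[OF CHAR_prime refl, of 1 "of_nat n :: 'a"] by simp
qed simp

text \<open>This range encodes the prime field: reduction modulo \<open>p\<close> leaves the images
  of \<open>0, ..., p - 1\<close>, which are distinct.\<close>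

lemma card_range_of_nat: "card (range (of_nat :: nat \<Rightarrow> 'a::finite_field)) = CHAR('a)"
proof -
  let ?p = "CHAR('a)"
  have mod: "of_nat n = (of_nat (n mod ?p) :: 'a)" for n
  proof -
    have "of_nat n = (of_nat (n div ?p * ?p + n mod ?p) :: 'a)"
      by simp
    also have "\<dots> = of_nat (n mod ?p)"
      by (simp only: of_nat_add of_nat_mult of_nat_CHAR mult_zero_right add_0_left)
    finally show ?thesis .
  qed
  have range: "range (of_nat :: nat \<Rightarrow> 'a) = of_nat ` {..<?p}"
  proof
    show "range (of_nat :: nat \<Rightarrow> 'a) \<subseteq> of_nat ` {..<?p}"
    proof
      fix x :: 'a assume "x \<in> range of_nat"
      then obtain n where "x = of_nat (n mod ?p)"
        using mod by auto
      moreover have "n mod ?p \<in> {..<?p}"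
        by simp
      ultimately show "x \<in> of_nat ` {..<?p}"
        by blast
    qed
  qed auto
  have neq: "of_nat m \<noteq> (of_nat n :: 'a)" if "m < n" "n < ?p" for m n
    using that of_nat_eq_iff_char_dvd[of m n, where 'a = 'a] nat_dvd_not_less[of "n - m" ?p] by simp
  have "inj_on (of_nat :: nat \<Rightarrow> 'a) {..<?p}"
    by (intro linorder_inj_onI') (use neq in auto)
  then show ?thesis
    by (simp add: range card_image)
qed

text \<open>The prime field is the fixed field of Frobenius: its \<open>p\<close> elements are
  already all the roots that \<open>X ^ p - X\<close> can have.\<close>

lemma power_CHAR_eq_self_iff:
  fixes x :: "'a::finite_field"
  shows "x ^ CHAR('a) = x \<longleftrightarrow> x \<in> range of_nat"
proof -
  let ?P = "monom 1 CHAR('a) - monom 1 1 :: 'a poly"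
  have p: "CHAR('a) > 1"
    using CHAR_prime by (rule prime_gt_1_nat)
  have "coeff ?P CHAR('a) \<noteq> 0"
    using p by simp
  then have "?P \<noteq> 0"
    by (metis coeff_0)
  have "card {x. poly ?P x = 0} \<le> degree ?P"
    by (rule card_poly_roots_bound) fact
  also have "\<dots> \<le> card (range (of_nat :: nat \<Rightarrow> 'a))"
    using p by (auto intro!: degree_diff_le order_trans[OF degree_monom_le] simp: card_range_of_nat)
  finally have "range of_nat = {x. poly ?P x = 0}"
    by (intro card_seteq) (auto simp: poly_monom power_CHAR_of_nat)
  then show ?thesis
    by (auto simp: poly_monom)
qed

lemma scalar_subfield_prime_field:
  fixes s :: "'a::finite_field \<Rightarrow> 'v::{ab_group_add, finite} \<Rightarrow> 'v"
  assumes "vector_space s"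
  shows "scalar_subfield s (range of_nat)"
proof -
  have "c - d \<in> range of_nat" if "c \<in> range of_nat" "d \<in> range of_nat" for c d :: 'a
    using that unfolding power_CHAR_eq_self_iff[symmetric]
    \<comment> \<open>Frobenius is additive on \<open>(c - d) + d\<close>, so it fixes
      \<open>c - d\<close> as well.\<close>
    using freshmans_dream[OF CHAR_prime refl, of "c - d" d] by (simp add: eq_diff_eq)
  moreover have "c * d \<in> range of_nat" if "c \<in> range of_nat" "d \<in> range of_nat" for c d :: 'a
    using that unfolding power_CHAR_eq_self_iff[symmetric] by (simp add: power_mult_distrib)
  moreover have "(1 :: 'a) \<in> range of_nat"
    unfolding power_CHAR_eq_self_iff[symmetric] by simp
  ultimately show ?thesis
    by (simp add: scalar_subfield_def scalar_subfield_axioms_def assms)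
qed

text \<open>Identifies the number of summands of the trace with the degree over the prime
  field.\<close>

lemma card_finite_field:
  "CARD('a::finite_field) = CHAR('a) ^ multiplicity CHAR('a) CARD('a)"
proof -
  interpret scalar_subfield "(*) :: 'a \<Rightarrow> 'a \<Rightarrow> 'a" "range of_nat"
    by (intro scalar_subfield_prime_field) (unfold_locales, simp_all add: algebra_simps)
  obtain m where "CARD('a) = CHAR('a) ^ m"
    using card_UNIV_power_card_K by (auto simp: card_range_of_nat)
  moreover have "multiplicity CHAR('a) (CHAR('a) ^ m) = m"
    by (intro multiplicity_same_power) (use CHAR_prime[where 'a = 'a] in auto)
  ultimately show ?thesis
    by simp
qed

section \<open>The trace to the prime field\<close>

lemma field_trace_add: "field_trace (x + y) = field_trace x + field_trace y"
  by (simp add: field_trace_def freshmans_dream'[OF CHAR_prime refl] sum.distrib)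

lemma field_trace_0: "field_trace (0 :: 'a::finite_field) = 0"
  by (simp add: field_trace_def power_0_left)

lemma field_trace_mult_of_nat:
  assumes "c \<in> range of_nat"
  shows "field_trace (c * x) = c * field_trace (x :: 'a::finite_field)"
proof -
  have "c ^ (CHAR('a) ^ i) = c" for i
    using assms by (induction i) (simp_all add: power_mult power_CHAR_eq_self_iff[symmetric])
  then show ?thesis
    by (simp add: field_trace_def power_mult_distrib sum_distrib_left)
qed

text \<open>Frobenius permutes the summands cyclically, because \<open>x ^ q = x\<close>; hence it
  fixes their sum.\<close>

lemma field_trace_in_range: "field_trace (x :: 'a::finite_field) \<in> range of_nat"
proof -
  let ?m = "multiplicity CHAR('a) CARD('a)"
  let ?f = "\<lambda>i. x ^ (CHAR('a) ^ i)"
  have "field_trace x ^ CHAR('a) = (\<Sum>i<?m. ?f (Suc i))"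
    by (simp add: field_trace_def freshmans_dream_sum[OF CHAR_prime refl] mult.commute flip: power_mult)
  moreover have "?f ?m = ?f 0"
    by (simp add: finite_field_power_card_eq_same flip: card_finite_field)
  then have "(\<Sum>i<?m. ?f (Suc i)) = (\<Sum>i<?m. ?f i)"
    using sum.lessThan_Suc_shift[of ?f ?m] sum.lessThan_Suc[of ?f ?m] by simp
  ultimately show ?thesis
    by (simp add: field_trace_def flip: power_CHAR_eq_self_iff)
qed

text \<open>Otherwise the trace polynomial, nonzero because of its linear coefficient, would have
  \<open>q\<close> roots with degree at most \<open>p ^ (m - 1)\<close>.\<close>

lemma exists_field_trace_neq_0: "\<exists>x :: 'a::finite_field. field_trace x \<noteq> 0"
proof (rule ccontr)
  assume "\<nexists>x :: 'a. field_trace x \<noteq> 0"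
  then have zero: "field_trace x = 0" for x :: 'a
    by blast
  let ?m = "multiplicity CHAR('a) CARD('a)"
  let ?P = "(\<Sum>i<?m. monom 1 (CHAR('a) ^ i)) :: 'a poly"
  have p: "CHAR('a) > 1"
    using CHAR_prime by (rule prime_gt_1_nat)
  have "CARD('a) > 1"
    using card_mono[of UNIV "{0, 1 :: 'a}"] by simp
  then have m: "?m > 0"
    using card_finite_field[where 'a = 'a] by (cases ?m) auto
  have "coeff ?P 1 = (\<Sum>i<?m. if i = 0 then 1 else 0)"
    unfolding coeff_sum coeff_monom using p by (intro sum.cong) auto
  then have "coeff ?P 1 \<noteq> 0"
    using m by simp
  then have "?P \<noteq> 0"
    by (metis coeff_0)
  have "CARD('a) = card {x. poly ?P x = 0}"
    using zero by (simp add: poly_sum poly_monom field_trace_def)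
  also have "\<dots> \<le> degree ?P"
    by (rule card_poly_roots_bound) fact
  also have "\<dots> \<le> CHAR('a) ^ (?m - 1)"
    using p by (intro degree_sum_le) (auto intro!: order_trans[OF degree_monom_le] power_increasing)
  also have "\<dots> < CHAR('a) ^ ?m"
    using p m by (intro power_strict_increasing) auto
  finally show False
    by (simp flip: card_finite_field)
qed

subsection \<open>The symplectic and the trace-symplectic form\<close>

definition symp :: "('a::field, 'n::finite) symp_vec \<Rightarrow> ('a, 'n) symp_vec \<Rightarrow> 'a" where
  "symp v w = scalar_product (fst w) (snd v) - scalar_product (fst v) (snd w)"

lemma trace_symp_eq: "trace_symp v w = field_trace (symp v w)"
  by (simp add: trace_symp_def symp_def)

lemma symp_add_left: "symp (u + v) w = symp u w + symp v w"
  and symp_add_right: "symp w (u + v) = symp w u + symp w v"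
  and symp_pscale_left: "symp (pscale c u) v = c * symp u v"
  and symp_self: "symp v v = 0"
  by (simp_all add: symp_def scalar_product_def algebra_simps sum.distrib sum_distrib_left)

text \<open>One entry, placed in the half opposite to a nonzero entry of \<open>v\<close>, suffices.
  Arbitrary \<open>t\<close> is allowed so that a value of nonzero trace can be chosen.\<close>

lemma symp_surj_local:
  fixes v :: "('a::field, 'n::finite) symp_vec"
  assumes "v \<noteq> 0"
  shows "\<exists>y. swt y \<le> 1 \<and> symp v y = t"
proof -
  have supp: "swt (axis i a, axis i b) \<le> 1" for i :: 'n and a b :: 'a
  proof -
    have "swt (axis i a, axis i b) \<le> card {i}"
      unfolding swt_def by (intro card_mono) (auto simp: axis_def split: if_splits)
    then show ?thesis
      by simp
  qed
  have sp: "scalar_product (axis i a) w = a * w $ i" "scalar_product w (axis i a) = a * w $ i"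
    for i :: 'n and a :: 'a and w
    by (simp_all add: scalar_product_def axis_def if_distrib if_distribR mult.commute cong: if_cong)
  obtain i where "fst v $ i \<noteq> 0 \<or> snd v $ i \<noteq> 0"
    using assms by (auto simp: prod_eq_iff vec_eq_iff)
  then show ?thesis
  proof
    assume "fst v $ i \<noteq> 0"
    then show ?thesis
      using supp[of i 0 "- t / fst v $ i"]
      by (intro exI[of _ "(axis i 0, axis i (- t / fst v $ i))"]) (simp add: symp_def sp)
  next
    assume "snd v $ i \<noteq> 0"
    then show ?thesis
      using supp[of i "t / snd v $ i" 0]
      by (intro exI[of _ "(axis i (t / snd v $ i), axis i 0)"]) (simp add: symp_def sp)
  qed
qed

lemma code_form_trace_symp:
  "code_form (range of_nat) (trace_symp :: ('a::finite_field, 'n::finite) symp_vec \<Rightarrow> _)"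
proof -
  interpret scalar_subfield "pscale :: 'a \<Rightarrow> ('a, 'n) symp_vec \<Rightarrow> _" "range of_nat"
    by (rule scalar_subfield_prime_field[OF vector_space_pscale])
  have nondegenerate: "\<exists>y. swt y \<le> 1 \<and> trace_symp v y \<noteq> 0"
    if "v \<noteq> 0" for v :: "('a, 'n) symp_vec"
    using exists_field_trace_neq_0[where 'a = 'a] symp_surj_local[OF that]
    by (metis trace_symp_eq)
  interpret symplectic_form pscale "range of_nat" "trace_symp :: ('a, 'n) symp_vec \<Rightarrow> _"
  proof
    show "\<exists>w. trace_symp v w \<noteq> 0" if "v \<noteq> 0" for v :: "('a, 'n) symp_vec"
      using nondegenerate[OF that] by blast
  qed (simp_all add: trace_symp_eq symp_add_left symp_add_right symp_pscale_left
      symp_self field_trace_add field_trace_0 field_trace_mult_of_nat field_trace_in_range)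
  show ?thesis
  proof
    show "\<exists>m. CARD('a) = card (range (of_nat :: nat \<Rightarrow> 'a)) ^ m"
      unfolding card_range_of_nat using card_finite_field by blast
  qed (use nondegenerate in \<open>simp_all only: symp_dual_def perp_def\<close>)
qed

text \<open>Multiplication by an element of the prime field is iterated addition.\<close>

lemma ksubspace_prime_field_iff:
  fixes C :: "('a::finite_field, 'n::finite) symp_vec set"
  shows "scalar_subfield.ksubspace pscale (range of_nat) C \<longleftrightarrow> additive_code C"
proof -
  interpret code_form "range of_nat" "trace_symp :: ('a, 'n) symp_vec \<Rightarrow> _"
    by (rule code_form_trace_symp)
  have "pscale (of_nat m) v \<in> C" if "additive_code C" "v \<in> C" for m v
  proof (induction m)
    case 0
    show ?case
      using that by (simp add: additive_code_def flip: zero_prod_def)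
  next
    case (Suc m)
    have "pscale (of_nat (Suc m)) v = v + pscale (of_nat m) v"
      by (simp add: prod_eq_iff vec_eq_iff algebra_simps)
    then show ?case
      using Suc that by (simp add: additive_code_def)
  qed
  then have "ksubspace C" if "additive_code C"
    using that unfolding ksubspace_def by (auto simp: additive_code_def)
  then show ?thesis
    using additive_code_if_ksubspace by blast
qed

lemma code_form_symp: "code_form UNIV (symp :: ('a::finite_field, 'n::finite) symp_vec \<Rightarrow> _)"
proof -
  interpret scalar_subfield "pscale :: 'a \<Rightarrow> ('a, 'n) symp_vec \<Rightarrow> _" UNIV
    by (simp add: scalar_subfield_def scalar_subfield_axioms_def vector_space_pscale)
  have nondegenerate: "\<exists>y. swt y \<le> 1 \<and> symp v y \<noteq> 0"
    if "v \<noteq> 0" for v :: "('a, 'n) symp_vec"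
    using symp_surj_local[OF that] by (metis one_neq_zero)
  interpret symplectic_form pscale UNIV "symp :: ('a, 'n) symp_vec \<Rightarrow> _"
  proof
    show "\<exists>w. symp v w \<noteq> 0" if "v \<noteq> 0" for v :: "('a, 'n) symp_vec"
      using nondegenerate[OF that] by blast
  qed (simp_all add: symp_add_left symp_add_right symp_pscale_left symp_self)
  have dual: "symp_dual C = perp C" if C: "ksubspace C" for C
  proof
    show "perp C \<subseteq> symp_dual C"
      by (auto simp: perp_def symp_dual_def trace_symp_eq field_trace_0)
    \<comment> \<open>If \<open>symp w v\<close> were nonzero, a multiple of \<open>w\<close> in
      \<open>C\<close> would pair with \<open>v\<close> to an element of nonzero trace.\<close>
    show "symp_dual C \<subseteq> perp C"
    proof (intro subsetI perpI, rule ccontr)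
      fix v w assume v: "v \<in> symp_dual C" and w: "w \<in> C" and neq: "symp w v \<noteq> 0"
      obtain t :: 'a where "field_trace t \<noteq> 0"
        using exists_field_trace_neq_0 by blast
      moreover have "pscale (t / symp w v) w \<in> C"
        by (intro ksubspace_scale C w) simp
      then have "field_trace (symp (pscale (t / symp w v) w) v) = 0"
        using v unfolding symp_dual_def trace_symp_eq by blast
      then have "field_trace t = 0"
        unfolding symp_pscale_left using neq by simp
      ultimately show False
        by simp
    qed
  qed
  show ?thesis
  proof
    show "\<exists>m. CARD('a) = card (UNIV :: 'a set) ^ m"
      by (rule exI[of _ 1]) simp
  qed (erule nondegenerate dual)+
qed

lemma ksubspace_UNIV_iff:
  fixes C :: "('a::finite_field, 'n::finite) symp_vec set"
  shows "scalar_subfield.ksubspace pscale UNIV C \<longleftrightarrow> linear_code C"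
proof -
  interpret code_form UNIV "symp :: ('a, 'n) symp_vec \<Rightarrow> _"
    by (rule code_form_symp)
  show ?thesis
    by (simp add: ksubspace_def linear_code_def subspace_def)
qed

lemma subsystem_code_additive: "subsystem_code C k r d \<Longrightarrow> additive_code C"
  by (simp add: subsystem_code_def clifford_subsystem_code_def)

theorem corollary15:
  shows
    "(\<forall>k d d'.
        (\<exists>C :: ('a::finite_field, 'n::finite) symp_vec set. stabilizer_code C k d \<and> pure_to C d')
        \<longrightarrow> (\<forall>r. 0 \<le> r \<and> r < k \<longrightarrow>
              (\<exists>(C :: ('a, 'n) symp_vec set) e. e \<ge> d \<and>
                  subsystem_code C (k - r) r e \<and> pure_to C (min d d')))) \<and>
     (\<forall>k r d.
        (\<exists>C :: ('a, 'n) symp_vec set. subsystem_code C k r d \<and> pure_to C d)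
        \<longrightarrow> (\<exists>C :: ('a, 'n) symp_vec set. stabilizer_code C (k + r) d \<and> pure_to C d)) \<and>
     (\<forall>k d d'.
        (\<exists>C :: ('a, 'n) symp_vec set.
            linear_code C \<and> stabilizer_code C k d \<and> pure_to C d')
        \<longrightarrow> (\<forall>r. 0 \<le> r \<and> r < k \<longrightarrow>
              (\<exists>(C :: ('a, 'n) symp_vec set) e. e \<ge> d \<and>
                  linear_code C \<and> subsystem_code C (k - r) r e \<and> pure_to C (min d d')))) \<and>
     (\<forall>k r d.
        (\<exists>C :: ('a, 'n) symp_vec set.
            linear_code C \<and> subsystem_code C k r d \<and> pure_to C d)
        \<longrightarrow> (\<exists>C :: ('a, 'n) symp_vec set.
              linear_code C \<and> stabilizer_code C (k + r) d \<and> pure_to C d))"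
proof -
  interpret additive: code_form "range of_nat" "trace_symp :: ('a, 'n) symp_vec \<Rightarrow> _"
    by (rule code_form_trace_symp)
  interpret linear: code_form UNIV "symp :: ('a, 'n) symp_vec \<Rightarrow> _"
    by (rule code_form_symp)
  note additive_rules = additive.subsystem_if_stabilizer additive.pure_stabilizer_if_pure_subsystem
  note linear_rules = linear.subsystem_if_stabilizer linear.pure_stabilizer_if_pure_subsystem
  \<comment> \<open>In the additive assertions, the additivity required by the lemmas is contained
    in the code predicates.\<close>
  show ?thesis
    using additive_rules[unfolded ksubspace_prime_field_iff] linear_rules[unfolded ksubspace_UNIV_iff]
      subsystem_code_additive[where 'a = 'a and 'b = 'n]
    unfolding stabilizer_code_def by meson
qed

end
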